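(* Let $\underline{\underline{M}}$ be a symmetric positive definite real matrix and $\underline{\underline{D}}$, $\underline{\underline{R}}$, $\underline{\underline{B}}$ be real matrices with $\underline{\underline{B}}=\operatorname{diag}(-1,1)$, $\underline{\underline{D}}\,\underline{1}=\underline{0}$ and $\underline{\underline{M}}\,\underline{\underline{D}}+\underline{\underline{D}}^T\underline{\underline{M}}=\underline{\underline{R}}^T\underline{\underline{B}}\,\underline{\underline{R}}$, as described in the context. Let $\underline{\underline{J}}$ be a (time-independent) matrix representing multiplication by the Jacobian $J=\partial_\xi x$ of a coordinate mapping, and consider the semidiscretisation on the reference element of the linear advection equation $\partial_tu+\partial_xu=0$, $$\underline{\underline{J}}\,\partial_t\underline{u}+\underline{\underline{D}}\,\underline{u}+\underline{\underline{M}}^{-1}\underline{\underline{R}}^T\underline{\underline{B}}\left(\underline{f}^{\mathrm{num}}-\underline{\underline{R}}\,\underline{u}\right)=\underline{0},$$ where $\underline{f}^{\mathrm{num}}\in\mathbb{R}^2$ contains the numerical fluxes at the left and right boundary. Then $$\underline{1}^T\underline{\underline{M}}\,\underline{\underline{J}}\,\partial_t\underline{u}=-\underline{1}^T\underline{\underline{R}}^T\underline{\underline{B}}\,\underline{f}^{\mathrm{num}},\qquad \underline{u}^T\underline{\underline{M}}\,\underline{\underline{J}}\,\partial_t\underline{u}=-\underline{u}^T\underline{\underline{R}}^T\underline{\underline{B}}\left(\underline{f}^{\mathrm{num}}-\frac12\underline{\underline{R}}\,\underline{u}\right).$$ Moreover, if $J=\partial_\xi x>0$, then $\underline{\underline{M}}\,\underline{\underline{J}}$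 is symmetric and positive definite in each of the following cases: (1) the basis is nodal with diagonal norm matrix $\underline{\underline{M}}$ and $\underline{\underline{J}}$ is the pointwise (diagonal) multiplication operator by the values of $J$ at the nodes; (2) the basis is the modal basis of Legendre polynomials of degree $\le p$ with exact $L^2([-1,1])$ mass matrix $\underline{\underline{M}}$, and $\underline{\underline{J}}$ represents exact multiplication by $J$ followed by exact $L^2$-orthogonal projection onto the polynomials of degree $\le p$; (3) $\underline{\underline{M}}$ and $\underline{\underline{J}}$ are obtained by a change of basis from matrices in another basis in which the product of the mass matrix and the multiplication matrix is symmetric and positive definite; that is, if $\underline{\underline{M}}_0\,\underline{\underline{J}}_0$ is symmetric and positive definite and $\underline{\underline{V}}$ is the invertible transformation matrix, then $\underline{\underline{M}}=\underline{\underline{V}}^T\underline{\underline{M}}_0\,\underline{\underline{V}}$ and $\underline{\underline{J}}=\underline{\underline{V}}^{-1}\underline{\underline{J}}_0\,\underline{\underline{V}}$.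
   Context: Numerical solutions on the reference element $[-1,1]$ lie in the space of polynomials of degree $\le p$, equipped with a fixed basis. $\underline{u}$ denotes the (time-dependent) coefficient vector of the solution, $\underline{1}$ that of the constant function $1$, and double underlines denote matrices. $\underline{\underline{M}}$ is the mass (norm) matrix approximating the $L^2$ scalar product, $\underline{\underline{D}}$ the derivative matrix (exact for constants), and $\underline{\underline{R}}$ the restriction matrix mapping a coefficient vector to the two boundary values at $-1$ and $1$. The identity $\underline{\underline{M}}\,\underline{\underline{D}}+\underline{\underline{D}}^T\underline{\underline{M}}=\underline{\underline{R}}^T\underline{\underline{B}}\,\underline{\underline{R}}$ is the summation-by-parts (SBP) property. A coordinate mapping between the physical element (coordinate $x$) and the reference element (coordinate $\xi\in[-1,1]$) has Jacobian $J=\partial_\xi x$, so that the advection equation becomes $J\,\partial_tu+\partial_\xi u=0$. In case (1), a nodal basis with diagonal norm means the coefficients are the values at nodes $\xi_0,\dots,\xi_p\in[-1,1]$ and $\underline{\underline{M}}=\operatorname{diag}(\omega_0,\dots,\omega_p)$ with positive weights $\omega_i$. In case (3), if $\underline{w}$ is the coefficient vector in the original basis and $\underline{u}$ in the new basis of the same polynomial, then $\underline{w}=\underline{\underline{V}}\,\underline{u}$. *)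

theory Defs
  imports
    "HOL-Analysis.Henstock_Kurzweil_Integration"
    "HOL-Computational_Algebra.Polynomial"
    "Jordan_Normal_Form.Gauss_Jordan_Elimination"
begin

(* HOL-Analysis uses the same symbol for the inner product of euclidean spaces. *)
no_notation inner (infix "\<bullet>" 70)

definition expansion :: "(nat \<Rightarrow> real poly) \<Rightarrow> real vec \<Rightarrow> real poly" where
  "expansion \<phi> c = (\<Sum>i<dim_vec c. Polynomial.smult (c $ i) (\<phi> i))"

definition poly_basis :: "nat \<Rightarrow> (nat \<Rightarrow> real poly) \<Rightarrow> bool" where
  "poly_basis p \<phi> \<longleftrightarrow>
     (\<forall>i\<le>p. degree (\<phi> i) \<le> p) \<and>
     (\<forall>q. degree q \<le> p \<longrightarrow> (\<exists>!c. c \<in> carrier_vec (p + 1) \<and> expansion \<phi> c = q))"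

definition sym_pos_def :: "nat \<Rightarrow> real mat \<Rightarrow> bool" where
  "sym_pos_def n A \<longleftrightarrow>
     A \<in> carrier_mat n n \<and> A\<^sup>T = A \<and>
     (\<forall>v \<in> carrier_vec n. v \<noteq> 0\<^sub>v n \<longrightarrow> v \<bullet> (A *\<^sub>v v) > 0)"

(* The library inverse is option-valued (None for singular matrices); it is only
   applied to invertible matrices here. *)
abbreviation mat_inv :: "real mat \<Rightarrow> real mat" where
  "mat_inv A \<equiv> the (mat_inverse A)"

(* Row 0 evaluates at the left boundary -1, row 1 at the right boundary 1. *)
definition restriction_mat :: "nat \<Rightarrow> (nat \<Rightarrow> real poly) \<Rightarrow> real mat" where
  "restriction_mat p \<phi> =
     mat 2 (p + 1) (\<lambda>(i, j). poly (\<phi> j) (if i = 0 then -1 else 1))"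

(* JNF vectors carry no topology, so time derivatives are taken componentwise. *)
definition vec_has_derivative_on ::
    "nat \<Rightarrow> (real \<Rightarrow> real vec) \<Rightarrow> (real \<Rightarrow> real vec) \<Rightarrow> real set \<Rightarrow> bool" where
  "vec_has_derivative_on n u u' T \<longleftrightarrow>
     (\<forall>t\<in>T. u t \<in> carrier_vec n \<and> u' t \<in> carrier_vec n \<and>
        (\<forall>i<n. ((\<lambda>s. u s $ i) has_real_derivative u' t $ i) (at t within T)))"

definition nodal_basis :: "nat \<Rightarrow> (nat \<Rightarrow> real poly) \<Rightarrow> (nat \<Rightarrow> real) \<Rightarrow> bool" where
  "nodal_basis p \<phi> node \<longleftrightarrow>
     (\<forall>i\<le>p. node i \<in> {-1..1}) \<and>
     (\<forall>c \<in> carrier_vec (p + 1). \<forall>i\<le>p. poly (expansion \<phi> c) (node i) = c $ i)"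

(* Rodrigues' formula, i.e. the normalisation with value 1 at the point 1. *)
definition legendre :: "nat \<Rightarrow> real poly" where
  "legendre n =
     Polynomial.smult (1 / (2 ^ n * fact n)) ((pderiv ^^ n) ([:-1, 0, 1:] ^ n))"

definition exact_mass_mat :: "nat \<Rightarrow> (nat \<Rightarrow> real poly) \<Rightarrow> real mat" where
  "exact_mass_mat p \<phi> =
     mat (p + 1) (p + 1)
       (\<lambda>(i, j). integral {-1..1} (\<lambda>\<xi>. poly (\<phi> i) \<xi> * poly (\<phi> j) \<xi>))"

definition L2_projection :: "nat \<Rightarrow> (real \<Rightarrow> real) \<Rightarrow> real poly \<Rightarrow> bool" where
  "L2_projection p f w \<longleftrightarrow>
     degree w \<le> p \<and>
     (\<forall>q. degree q \<le> p \<longrightarrow>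
        ((\<lambda>\<xi>. (f \<xi> - poly w \<xi>) * poly q \<xi>) has_integral 0) {-1..1})"

definition projected_mult_mat ::
    "nat \<Rightarrow> (nat \<Rightarrow> real poly) \<Rightarrow> (real \<Rightarrow> real) \<Rightarrow> real mat \<Rightarrow> bool" where
  "projected_mult_mat p \<phi> g A \<longleftrightarrow>
     A \<in> carrier_mat (p + 1) (p + 1) \<and>
     (\<forall>c \<in> carrier_vec (p + 1).
        L2_projection p (\<lambda>\<xi>. g \<xi> * poly (expansion \<phi> c) \<xi>) (expansion \<phi> (A *\<^sub>v c)))"

definition basis_change ::
    "nat \<Rightarrow> (nat \<Rightarrow> real poly) \<Rightarrow> (nat \<Rightarrow> real poly) \<Rightarrow> real mat \<Rightarrow> bool" where
  "basis_change p \<phi>\<^sub>0 \<phi> V \<longleftrightarrow>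
     V \<in> carrier_mat (p + 1) (p + 1) \<and> invertible_mat V \<and>
     (\<forall>c \<in> carrier_vec (p + 1). expansion \<phi>\<^sub>0 (V *\<^sub>v c) = expansion \<phi> c)"

end

theory Submission
  imports Defs "Jordan_Normal_Form.Determinant"
begin

text \<open>
  Multiplying the semidiscretisation by \<open>v\<^sup>T M\<close> removes the inverse mass matrix from the
  boundary term and leaves
  \<open>v\<^sup>T M J u' = - v\<^sup>T M D u - v\<^sup>T R\<^sup>T B (f - R u)\<close>. Summation by parts is then used twice.
  For \<open>v = 1\<close> it moves the derivative onto the constant, where it vanishes, so that
  \<open>1\<^sup>T M D u = 1\<^sup>T R\<^sup>T B R u\<close>; for \<open>v = u\<close> the two volume terms agree by symmetry of \<open>M\<close>, so
  that \<open>u\<^sup>T M D u\<close> is half of \<open>u\<^sup>T R\<^sup>T B R u\<close>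
  (\<open>SBP_conservation\<close>, \<open>SBP_energy\<close>). Both identities are pointwise in time.

  For the positivity of \<open>M J\<close>, the nodal case is a product of positive diagonal matrices and a
  change of basis turns \<open>M\<^sub>0 J\<^sub>0\<close> into the congruent matrix \<open>V\<^sup>T (M\<^sub>0 J\<^sub>0) V\<close>. In the modal
  case, testing the projection against polynomials of degree \<open>\<le> p\<close> removes it again, so that
  \<open>v\<^sup>T M J w\<close> is the integral of the Jacobian times the polynomials with coefficients \<open>v\<close> and
  \<open>w\<close> (\<open>projected_mult_bilinear_form\<close>). This form is symmetric. It is definite because the
  Jacobian is a positive derivative: its integral over any nondegenerate interval is an increment
  of the strictly increasing coordinate map, which bounds the weighted integral of a square from
  below (\<open>has_integral_derivative_weight_pos\<close>).
\<close>

(* Keeps v $ i unambiguous: vectors over a finite index type use the same symbol. *)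
no_notation vec_nth (infixl "$" 90)

section \<open>Symmetric positive definite matrices\<close>

lemma sym_pos_defI:
  assumes A: "A \<in> carrier_mat n n"
    and sym: "\<And>v w. v \<in> carrier_vec n \<Longrightarrow> w \<in> carrier_vec n \<Longrightarrow>
      v \<bullet> (A *\<^sub>v w) = w \<bullet> (A *\<^sub>v v)"
    and pos: "\<And>v. v \<in> carrier_vec n \<Longrightarrow> v \<noteq> 0\<^sub>v n \<Longrightarrow> v \<bullet> (A *\<^sub>v v) > 0"
  shows "sym_pos_def n A"
proof -
  have entry: "unit_vec n i \<bullet> (A *\<^sub>v unit_vec n j) = A $$ (i, j)" if "i < n" "j < n" for i j
  proof -
    have "A *\<^sub>v unit_vec n j \<in> carrier_vec n" using A by simp
    then show ?thesis using A that by (simp add: scalar_prod_right_unit)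
  qed
  have "A\<^sup>T = A"
  proof (rule eq_matI)
    fix i j assume "i < dim_row A" "j < dim_col A"
    then have ij: "i < n" "j < n" using A by auto
    then have "A $$ (j, i) = A $$ (i, j)"
      using entry[of i j] entry[of j i] sym[of "unit_vec n i" "unit_vec n j"] by simp
    then show "A\<^sup>T $$ (i, j) = A $$ (i, j)" using A ij by simp
  qed (use A in auto)
  then show ?thesis using A pos unfolding sym_pos_def_def by blast
qed

lemma sym_pos_def_bilinear_commute:
  assumes "sym_pos_def n A" "v \<in> carrier_vec n" "w \<in> carrier_vec n"
  shows "v \<bullet> (A *\<^sub>v w) = w \<bullet> (A *\<^sub>v v)"
proof -
  have A: "A \<in> carrier_mat n n" "A\<^sup>T = A" using assms(1) by (auto simp: sym_pos_def_def)
  have "v \<bullet> (A *\<^sub>v w) = (A\<^sup>T *\<^sub>v v) \<bullet> w"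
    by (rule transpose_vec_mult_scalar[OF A(1) assms(3,2), symmetric])
  also have "\<dots> = w \<bullet> (A *\<^sub>v v)"
    unfolding A(2) by (rule comm_scalar_prod[of _ n]) (use A(1) assms in auto)
  finally show ?thesis .
qed

lemma mat_inv_of_Units:
  assumes A: "A \<in> carrier_mat n n" and unit: "A \<in> Units (ring_mat TYPE(real) n b)"
  shows "A * mat_inv A = 1\<^sub>m n" "mat_inv A * A = 1\<^sub>m n" "mat_inv A \<in> carrier_mat n n"
proof -
  from mat_inverse(1)[OF A, of b] unit obtain B where "mat_inverse A = Some B"
    by (cases "mat_inverse A") auto
  with mat_inverse(2)[OF A this]
  show "A * mat_inv A = 1\<^sub>m n" "mat_inv A * A = 1\<^sub>m n" "mat_inv A \<in> carrier_mat n n"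
    by auto
qed

text \<open>A positive definite matrix has trivial kernel, hence nonzero determinant.\<close>

lemma sym_pos_def_inverse:
  assumes "sym_pos_def n A"
  shows "A * mat_inv A = 1\<^sub>m n" "mat_inv A \<in> carrier_mat n n"
proof -
  have A: "A \<in> carrier_mat n n" using assms by (auto simp: sym_pos_def_def)
  have "det A \<noteq> 0"
  proof
    assume "det A = 0"
    then obtain v where v: "v \<in> carrier_vec n" "v \<noteq> 0\<^sub>v n" "A *\<^sub>v v = 0\<^sub>v n"
      using det_0_iff_vec_prod_zero_field[OF A] by auto
    then have "v \<bullet> 0\<^sub>v n > 0" using assms unfolding sym_pos_def_def by force
    then show False using v(1) by simp
  qed
  then have "A \<in> Units (ring_mat TYPE(real) n ())" by (rule det_non_zero_imp_unit[OF A])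
  from mat_inv_of_Units[OF A this]
  show "A * mat_inv A = 1\<^sub>m n" "mat_inv A \<in> carrier_mat n n" by auto
qed

lemma invertible_mat_inverse:
  fixes A :: "real mat"
  assumes A: "A \<in> carrier_mat n n" and inv: "invertible_mat A"
  shows "A * mat_inv A = 1\<^sub>m n" "mat_inv A * A = 1\<^sub>m n" "mat_inv A \<in> carrier_mat n n"
proof -
  obtain B where B: "A * B = 1\<^sub>m n" "B * A = 1\<^sub>m (dim_row B)"
    using inv A unfolding invertible_mat_def inverts_mat_def by auto
  have "dim_col B = n" "dim_row B = n"
    using arg_cong[OF B(1), of dim_col] arg_cong[OF B(2), of dim_col] A by simp_all
  then have Bc: "B \<in> carrier_mat n n" and BA: "B * A = 1\<^sub>m n" using B(2) by auto
  have "A \<in> Units (ring_mat TYPE(real) n ())"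
    unfolding Units_def ring_mat_def using A Bc B(1) BA by auto
  from mat_inv_of_Units[OF A this]
  show "A * mat_inv A = 1\<^sub>m n" "mat_inv A * A = 1\<^sub>m n" "mat_inv A \<in> carrier_mat n n" .
qed

lemma sym_pos_def_mat_diag:
  assumes pos: "\<And>i. i < n \<Longrightarrow> d i > 0"
  shows "sym_pos_def n (mat_diag n d)"
proof -
  have form: "v \<bullet> (mat_diag n d *\<^sub>v w) = (\<Sum>i<n. d i * (v $ i * w $ i))"
    if w: "w \<in> carrier_vec n" for v w
  proof -
    have "(mat_diag n d *\<^sub>v w) $ i = d i * w $ i" if i: "i < n" for i
    proof -
      have "(mat_diag n d *\<^sub>v w) $ i = (\<Sum>j\<in>{0..<n}. (if i = j then d j else 0) * w $ j)"
        using w i by (simp add: mat_diag_def scalar_prod_def)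
      also have "\<dots> = (\<Sum>j\<in>{0..<n}. if i = j then d j * w $ j else 0)"
        by (rule sum.cong) auto
      also have "\<dots> = d i * w $ i" using i by simp
      finally show ?thesis .
    qed
    moreover have "dim_vec (mat_diag n d *\<^sub>v w) = n" by (simp add: mat_diag_def)
    ultimately show ?thesis
      unfolding scalar_prod_def by (auto simp: atLeast0LessThan intro!: sum.cong)
  qed
  show ?thesis
  proof (rule sym_pos_defI)
    fix v :: "real vec" assume v: "v \<in> carrier_vec n" "v \<noteq> 0\<^sub>v n"
    then obtain i where i: "i < n" "v $ i \<noteq> 0"
      by (metis carrier_vecD eq_vecI index_zero_vec)
    have "0 < d i * (v $ i * v $ i)"
      using pos[OF i(1)] i(2) by (metis mult_pos_pos not_real_square_gt_zero)
    also have "\<dots> \<le> (\<Sum>i<n. d i * (v $ i * v $ i))"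
      by (rule member_le_sum) (use i pos in \<open>auto simp: less_imp_le\<close>)
    finally show "v \<bullet> (mat_diag n d *\<^sub>v v) > 0" using form[OF v(1)] by simp
  qed (simp_all add: form mult.commute)
qed

lemma sym_pos_def_congruence:
  assumes A: "sym_pos_def n A" and V: "V \<in> carrier_mat n n" "invertible_mat V"
  shows "sym_pos_def n (V\<^sup>T * A * V)"
proof -
  have Ac: "A \<in> carrier_mat n n" using A by (auto simp: sym_pos_def_def)
  have form: "v \<bullet> ((V\<^sup>T * A * V) *\<^sub>v w) = (V *\<^sub>v v) \<bullet> (A *\<^sub>v (V *\<^sub>v w))"
    if vw: "v \<in> carrier_vec n" "w \<in> carrier_vec n" for v w
  proof -
    have y: "A *\<^sub>v (V *\<^sub>v w) \<in> carrier_vec n" using Ac V vw by auto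
    have "(V\<^sup>T * A * V) *\<^sub>v w = V\<^sup>T *\<^sub>v (A *\<^sub>v (V *\<^sub>v w))"
      using Ac V vw by (simp add: assoc_mult_mat_vec[of _ n n _ n])
    then have "v \<bullet> ((V\<^sup>T * A * V) *\<^sub>v w) = v \<bullet> (V\<^sup>T *\<^sub>v (A *\<^sub>v (V *\<^sub>v w)))"
      by (rule arg_cong)
    also have "\<dots> = (V\<^sup>T *\<^sub>v (A *\<^sub>v (V *\<^sub>v w))) \<bullet> v"
      by (rule comm_scalar_prod[OF vw(1)]) (use V(1) y in auto)
    also have "\<dots> = (A *\<^sub>v (V *\<^sub>v w)) \<bullet> (V *\<^sub>v v)"
      by (rule transpose_vec_mult_scalar[OF V(1) vw(1) y])
    also have "\<dots> = (V *\<^sub>v v) \<bullet> (A *\<^sub>v (V *\<^sub>v w))"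
      by (rule comm_scalar_prod[OF y]) (use V vw in auto)
    finally show ?thesis .
  qed
  show ?thesis
  proof (rule sym_pos_defI)
    show "V\<^sup>T * A * V \<in> carrier_mat n n" using Ac V by auto
  next
    fix v w :: "real vec" assume vw: "v \<in> carrier_vec n" "w \<in> carrier_vec n"
    show "v \<bullet> ((V\<^sup>T * A * V) *\<^sub>v w) = w \<bullet> ((V\<^sup>T * A * V) *\<^sub>v v)"
      unfolding form[OF vw] form[OF vw(2,1)]
      by (rule sym_pos_def_bilinear_commute[OF A]) (use V(1) vw in auto)
  next
    fix v :: "real vec" assume v: "v \<in> carrier_vec n" "v \<noteq> 0\<^sub>v n"
    have "V *\<^sub>v v \<noteq> 0\<^sub>v n"
    proof
      assume 0: "V *\<^sub>v v = 0\<^sub>v n"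
      have "v = (mat_inv V * V) *\<^sub>v v"
        using invertible_mat_inverse(2)[OF V] v(1) by simp
      also have "\<dots> = mat_inv V *\<^sub>v (V *\<^sub>v v)"
        by (rule assoc_mult_mat_vec[OF invertible_mat_inverse(3)[OF V] V(1) v(1)])
      also have "\<dots> = 0\<^sub>v n"
        unfolding 0 using invertible_mat_inverse(3)[OF V] by auto
      finally show False using v(2) by simp
    qed
    moreover have "V *\<^sub>v v \<in> carrier_vec n" using V(1) v(1) by simp
    ultimately show "v \<bullet> ((V\<^sup>T * A * V) *\<^sub>v v) > 0"
      unfolding form[OF v(1) v(1)] using A unfolding sym_pos_def_def by blast
  qed
qed

section \<open>Conservation and energy balance\<close>

lemma SBP_bilinear:
  fixes M D Q :: "real mat"
  assumes c: "M \<in> carrier_mat n n" "D \<in> carrier_mat n n"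
    and SBP: "M * D + D\<^sup>T * M = Q"
    and vw: "v \<in> carrier_vec n" "w \<in> carrier_vec n"
  shows "v \<bullet> (M *\<^sub>v (D *\<^sub>v w)) + (D *\<^sub>v v) \<bullet> (M *\<^sub>v w) = v \<bullet> (Q *\<^sub>v w)"
proof -
  have y: "M *\<^sub>v w \<in> carrier_vec n" using c vw by auto
  have "(D *\<^sub>v v) \<bullet> (M *\<^sub>v w) = (M *\<^sub>v w) \<bullet> (D *\<^sub>v v)"
    by (rule comm_scalar_prod[of _ n]) (use c vw in auto)
  also have "\<dots> = (D\<^sup>T *\<^sub>v (M *\<^sub>v w)) \<bullet> v"
    by (rule transpose_vec_mult_scalar[OF c(2) vw(1) y, symmetric])
  also have "\<dots> = v \<bullet> (D\<^sup>T *\<^sub>v (M *\<^sub>v w))"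
    by (rule comm_scalar_prod[of _ n]) (use c vw in auto)
  finally have "(D *\<^sub>v v) \<bullet> (M *\<^sub>v w) = v \<bullet> (D\<^sup>T *\<^sub>v (M *\<^sub>v w))" .
  moreover have "Q *\<^sub>v w = M *\<^sub>v (D *\<^sub>v w) + D\<^sup>T *\<^sub>v (M *\<^sub>v w)"
    unfolding SBP[symmetric] using c vw
    by (simp add: add_mult_distrib_mat_vec[of _ n n] assoc_mult_mat_vec[of _ n n _ n])
  moreover have "v \<bullet> (M *\<^sub>v (D *\<^sub>v w) + D\<^sup>T *\<^sub>v (M *\<^sub>v w)) =
      v \<bullet> (M *\<^sub>v (D *\<^sub>v w)) + v \<bullet> (D\<^sup>T *\<^sub>v (M *\<^sub>v w))"
    by (rule scalar_prod_add_distrib[of _ n]) (use c vw in auto)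
  ultimately show ?thesis by simp
qed

text \<open>Testing with \<open>v\<^sup>T M\<close> cancels the inverse mass matrix in front of the boundary
  correction.\<close>

lemma semidiscretisation_tested:
  fixes M D R B J :: "real mat"
  assumes M: "sym_pos_def n M"
    and c: "D \<in> carrier_mat n n" "J \<in> carrier_mat n n" "R \<in> carrier_mat m n" "B \<in> carrier_mat m m"
    and v: "v \<in> carrier_vec n" "w \<in> carrier_vec n" "w' \<in> carrier_vec n" "f \<in> carrier_vec m"
    and eq: "J *\<^sub>v w' + D *\<^sub>v w + (mat_inv M * R\<^sup>T * B) *\<^sub>v (f - R *\<^sub>v w) = 0\<^sub>v n"
  shows "v \<bullet> ((M * J) *\<^sub>v w') =
    - (v \<bullet> (M *\<^sub>v (D *\<^sub>v w))) - v \<bullet> ((R\<^sup>T * B) *\<^sub>v f) + v \<bullet> ((R\<^sup>T * B * R) *\<^sub>v w)"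
proof -
  have Mc: "M \<in> carrier_mat n n" using M by (auto simp: sym_pos_def_def)
  note Mi = sym_pos_def_inverse[OF M]
  define g where "g = f - R *\<^sub>v w"
  define K where "K = R\<^sup>T * B"
  have g: "g \<in> carrier_vec m" and K: "K \<in> carrier_mat n m" unfolding g_def K_def using c v by auto
  have S: "mat_inv M * R\<^sup>T * B = mat_inv M * K"
    unfolding K_def using Mi c by (intro assoc_mult_mat[of _ n n _ m _ m]) auto
  have "M *\<^sub>v ((mat_inv M * K) *\<^sub>v g) = (M * mat_inv M) *\<^sub>v (K *\<^sub>v g)"
    using Mc Mi(2) K g by (simp add: assoc_mult_mat_vec[of _ n n _ n] assoc_mult_mat_vec[of _ n n _ m])
  also have "\<dots> = K *\<^sub>v g" using Mi(1) K g by simp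
  finally have P: "M *\<^sub>v ((mat_inv M * K) *\<^sub>v g) = K *\<^sub>v g" .
  have cs: "J *\<^sub>v w' \<in> carrier_vec n" "D *\<^sub>v w \<in> carrier_vec n"
      "(mat_inv M * K) *\<^sub>v g \<in> carrier_vec n" "K *\<^sub>v g \<in> carrier_vec n"
      "K *\<^sub>v f \<in> carrier_vec n" "K *\<^sub>v (R *\<^sub>v w) \<in> carrier_vec n"
    using c v Mi K g by auto
  have "0\<^sub>v n = M *\<^sub>v (J *\<^sub>v w' + D *\<^sub>v w + (mat_inv M * K) *\<^sub>v g)"
    using eq Mc unfolding S g_def by auto
  also have "\<dots> = M *\<^sub>v (J *\<^sub>v w') + M *\<^sub>v (D *\<^sub>v w) + K *\<^sub>v g"
    using Mc cs
    by (simp add: mult_add_distrib_mat_vec[of _ n n] P assoc_add_vec[of _ n]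
        mult_mat_vec_carrier[of _ n n])
  finally have "v \<bullet> 0\<^sub>v n = v \<bullet> (M *\<^sub>v (J *\<^sub>v w') + M *\<^sub>v (D *\<^sub>v w) + K *\<^sub>v g)" by simp
  also have "\<dots> = v \<bullet> (M *\<^sub>v (J *\<^sub>v w')) + v \<bullet> (M *\<^sub>v (D *\<^sub>v w)) + v \<bullet> (K *\<^sub>v g)"
    using Mc cs v
    by (simp add: scalar_prod_add_distrib[of _ n] mult_mat_vec_carrier[of _ n n])
  also have "K *\<^sub>v g = K *\<^sub>v f - K *\<^sub>v (R *\<^sub>v w)"
    unfolding g_def by (rule mult_minus_distrib_mat_vec[OF K]) (use c v in auto)
  also have "v \<bullet> (K *\<^sub>v f - K *\<^sub>v (R *\<^sub>v w)) = v \<bullet> (K *\<^sub>v f) - v \<bullet> (K *\<^sub>v (R *\<^sub>v w))"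
    by (rule scalar_prod_minus_distrib[of _ n]) (use v cs in auto)
  also have "K *\<^sub>v (R *\<^sub>v w) = (K * R) *\<^sub>v w"
    using K c v by (simp add: assoc_mult_mat_vec[of _ n m _ n])
  also have "M *\<^sub>v (J *\<^sub>v w') = (M * J) *\<^sub>v w'"
    using Mc c v by (simp add: assoc_mult_mat_vec[of _ n n _ n])
  finally show ?thesis using v(1) unfolding K_def by simp
qed

text \<open>Summation by parts moves the derivative onto the test vector, which \<open>D\<close> annihilates; the
  boundary terms in \<open>w\<close> then cancel and only the numerical flux remains.\<close>

lemma SBP_conservation:
  fixes M D R B J :: "real mat"
  assumes M: "sym_pos_def n M"
    and c: "D \<in> carrier_mat n n" "J \<in> carrier_mat n n" "R \<in> carrier_mat m n" "B \<in> carrier_mat m m"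
    and SBP: "M * D + D\<^sup>T * M = R\<^sup>T * B * R"
    and v: "v \<in> carrier_vec n" "w \<in> carrier_vec n" "w' \<in> carrier_vec n" "f \<in> carrier_vec m"
    and eq: "J *\<^sub>v w' + D *\<^sub>v w + (mat_inv M * R\<^sup>T * B) *\<^sub>v (f - R *\<^sub>v w) = 0\<^sub>v n"
    and const: "D *\<^sub>v v = 0\<^sub>v n"
  shows "v \<bullet> ((M * J) *\<^sub>v w') = - (v \<bullet> ((R\<^sup>T * B) *\<^sub>v f))"
proof -
  have Mc: "M \<in> carrier_mat n n" using M by (auto simp: sym_pos_def_def)
  have "M *\<^sub>v w \<in> carrier_vec n" using Mc v by auto
  then have "(D *\<^sub>v v) \<bullet> (M *\<^sub>v w) = 0" unfolding const by simp
  then show ?thesis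
    using SBP_bilinear[OF Mc c(1) SBP v(1,2)] semidiscretisation_tested[OF M c v eq] by simp
qed

text \<open>The two volume terms in the summation-by-parts identity for \<open>w\<close> against itself coincide
  because \<open>M\<close> is symmetric; this is the origin of the factor one half.\<close>

lemma SBP_energy:
  fixes M D R B J :: "real mat"
  assumes M: "sym_pos_def n M"
    and c: "D \<in> carrier_mat n n" "J \<in> carrier_mat n n" "R \<in> carrier_mat m n" "B \<in> carrier_mat m m"
    and SBP: "M * D + D\<^sup>T * M = R\<^sup>T * B * R"
    and v: "w \<in> carrier_vec n" "w' \<in> carrier_vec n" "f \<in> carrier_vec m"
    and eq: "J *\<^sub>v w' + D *\<^sub>v w + (mat_inv M * R\<^sup>T * B) *\<^sub>v (f - R *\<^sub>v w) = 0\<^sub>v n"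
  shows "w \<bullet> ((M * J) *\<^sub>v w') = - (w \<bullet> ((R\<^sup>T * B) *\<^sub>v (f - (1/2) \<cdot>\<^sub>v (R *\<^sub>v w))))"
proof -
  have Mc: "M \<in> carrier_mat n n" using M by (auto simp: sym_pos_def_def)
  have Dw: "D *\<^sub>v w \<in> carrier_vec n" and Rw: "R *\<^sub>v w \<in> carrier_vec m"
    and K: "R\<^sup>T * B \<in> carrier_mat n m" using c v by auto
  have KR: "R\<^sup>T * B * R \<in> carrier_mat n n" using K c(3) by (rule mult_carrier_mat)
  have half: "2 * (w \<bullet> (M *\<^sub>v (D *\<^sub>v w))) = w \<bullet> ((R\<^sup>T * B * R) *\<^sub>v w)"
    using SBP_bilinear[OF Mc c(1) SBP v(1,1)] sym_pos_def_bilinear_commute[OF M v(1) Dw] by simp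
  have "(R\<^sup>T * B) *\<^sub>v (f - (1/2) \<cdot>\<^sub>v (R *\<^sub>v w)) =
      (R\<^sup>T * B) *\<^sub>v f - (R\<^sup>T * B) *\<^sub>v ((1/2) \<cdot>\<^sub>v (R *\<^sub>v w))"
    by (rule mult_minus_distrib_mat_vec[OF K v(3)]) (use Rw in auto)
  also have "(R\<^sup>T * B) *\<^sub>v ((1/2) \<cdot>\<^sub>v (R *\<^sub>v w)) = (1/2) \<cdot>\<^sub>v ((R\<^sup>T * B) *\<^sub>v (R *\<^sub>v w))"
    by (rule mult_mat_vec[OF K Rw])
  also have "(R\<^sup>T * B) *\<^sub>v (R *\<^sub>v w) = (R\<^sup>T * B * R) *\<^sub>v w"
    by (rule assoc_mult_mat_vec[OF K c(3) v(1), symmetric])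
  finally have "w \<bullet> ((R\<^sup>T * B) *\<^sub>v (f - (1/2) \<cdot>\<^sub>v (R *\<^sub>v w))) =
      w \<bullet> ((R\<^sup>T * B) *\<^sub>v f - (1/2) \<cdot>\<^sub>v ((R\<^sup>T * B * R) *\<^sub>v w))" by simp
  also have "\<dots> = w \<bullet> ((R\<^sup>T * B) *\<^sub>v f) - w \<bullet> ((1/2) \<cdot>\<^sub>v ((R\<^sup>T * B * R) *\<^sub>v w))"
    by (rule scalar_prod_minus_distrib[of _ n])
      (use v mult_mat_vec_carrier[OF K v(3)] mult_mat_vec_carrier[OF KR v(1)] in auto)
  also have "w \<bullet> ((1/2) \<cdot>\<^sub>v ((R\<^sup>T * B * R) *\<^sub>v w)) = (1/2) * (w \<bullet> ((R\<^sup>T * B * R) *\<^sub>v w))"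
    by (rule scalar_prod_smult_distrib[of _ n, OF v(1) mult_mat_vec_carrier[of _ n n]])
      (use KR v in auto)
  finally show ?thesis
    using half semidiscretisation_tested[OF M c v(1,1,2,3) eq] by simp
qed

section \<open>Projected multiplication by a positive derivative\<close>

text \<open>
  A derivative is integrable in the Henstock-Kurzweil sense without being continuous, and its
  integral over a short interval where \<open>f\<close> stays above \<open>f c / 2\<close> is an increment of the strictly
  increasing antiderivative \<open>G\<close>; this increment carries the lower bound.
\<close>

lemma has_integral_derivative_weight_pos:
  fixes f g G :: "real \<Rightarrow> real"
  assumes deriv: "\<And>t. t \<in> {a..b} \<Longrightarrow> (G has_real_derivative g t) (at t within {a..b})"
    and pos: "\<And>t. t \<in> {a..b} \<Longrightarrow> g t > 0"
    and cont: "continuous_on {a..b} f"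
    and nonneg: "\<And>t. t \<in> {a..b} \<Longrightarrow> f t \<ge> 0"
    and c: "c \<in> {a..<b}" "f c > 0"
    and int: "((\<lambda>t. g t * f t) has_integral I) {a..b}"
  shows "I > 0"
proof -
  have "c \<in> {a..b}" "f c / 2 > 0" using c by auto
  from cont[unfolded continuous_on_iff, rule_format, OF this]
  obtain e where e: "e > 0" "\<And>t. t \<in> {a..b} \<Longrightarrow> dist t c < e \<Longrightarrow> dist (f t) (f c) < f c / 2"
    by blast
  (* e / 2 rather than e, so that the closed interval [c, d] stays strictly within distance e. *)
  define d where "d = min b (c + e / 2)"
  have d: "c < d" "{c..d} \<subseteq> {a..b}" unfolding d_def using c e(1) by auto
  have low: "f c / 2 \<le> f t" if "t \<in> {c..d}" for t
  proof -
    have "dist t c < e" using that e(1) by (auto simp: d_def dist_real_def)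
    then have "dist (f t) (f c) < f c / 2" using e(2) that d(2) by blast
    then show ?thesis unfolding dist_real_def by linarith
  qed
  have G': "(G has_real_derivative g t) (at t within {c..d})" if "t \<in> {c..d}" for t
    using deriv[of t] that d(2) by (meson DERIV_subset subsetD)
  have Gint: "(g has_integral (G d - G c)) {c..d}"
    by (rule fundamental_theorem_of_calculus)
      (use d(1) G' in \<open>auto simp: has_real_derivative_iff_has_vector_derivative\<close>)
  have "G c < G d"
  proof (rule DERIV_pos_imp_increasing_open[OF d(1)])
    fix t assume t: "c < t" "t < d"
    then have "(G has_real_derivative g t) (at t)"
      using G'[of t] by (simp add: at_within_Icc_at)
    then show "\<exists>y. (G has_real_derivative y) (at t) \<and> y > 0" using pos[of t] t d(2) by force
  next
    show "continuous_on {c..d} G" by (rule DERIV_continuous_on) (rule G')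
  qed
  have sub: "((\<lambda>t. g t * f t) has_integral integral {c..d} (\<lambda>t. g t * f t)) {c..d}"
    by (rule integrable_integral[OF integrable_subinterval_real[OF has_integral_integrable[OF int] d(2)]])
  from \<open>G c < G d\<close> have "0 < (G d - G c) * (f c / 2)" using c(2) by simp
  also have "\<dots> \<le> integral {c..d} (\<lambda>t. g t * f t)"
  proof (rule has_integral_le)
    show "((\<lambda>t. g t * (f c / 2)) has_integral (G d - G c) * (f c / 2)) {c..d}"
      by (rule has_integral_mult_left[OF Gint])
    show "((\<lambda>t. g t * f t) has_integral integral {c..d} (\<lambda>t. g t * f t)) {c..d}"
      by (rule sub)
    fix t assume "t \<in> {c..d}"
    then show "g t * (f c / 2) \<le> g t * f t"
      using low[of t] pos[of t] d(2) by (intro mult_left_mono) (auto intro: less_imp_le)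
  qed
  also have "\<dots> \<le> I"
  proof (rule has_integral_subset_le[OF d(2) _ int])
    show "((\<lambda>t. g t * f t) has_integral integral {c..d} (\<lambda>t. g t * f t)) {c..d}"
      by (rule sub)
    show "\<forall>t\<in>{a..b}. 0 \<le> g t * f t"
      using pos nonneg by (simp add: less_imp_le)
  qed
  finally show ?thesis .
qed

lemma degree_expansion_le:
  assumes "poly_basis p \<phi>" "c \<in> carrier_vec (p + 1)"
  shows "degree (expansion \<phi> c) \<le> p"
  unfolding expansion_def
proof (rule degree_sum_le)
  fix i assume "i \<in> {..<dim_vec c}"
  then have "degree (\<phi> i) \<le> p" using assms unfolding poly_basis_def by auto
  then show "degree (Polynomial.smult (c $ i) (\<phi> i)) \<le> p"
    by (rule order_trans[OF degree_smult_le])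
qed simp

lemma expansion_eq_0_iff:
  assumes "poly_basis p \<phi>" "c \<in> carrier_vec (p + 1)"
  shows "expansion \<phi> c = 0 \<longleftrightarrow> c = 0\<^sub>v (p + 1)"
proof -
  have zero: "expansion \<phi> (0\<^sub>v (p + 1)) = 0" by (simp add: expansion_def)
  have "degree (0 :: real poly) \<le> p" by simp
  then have "\<exists>!c. c \<in> carrier_vec (p + 1) \<and> expansion \<phi> c = 0"
    using assms(1) unfolding poly_basis_def by blast
  then show ?thesis using zero assms(2) zero_carrier_vec by metis
qed

lemma exact_mass_mat_bilinear_form:
  assumes v: "v \<in> carrier_vec (p + 1)" and w: "w \<in> carrier_vec (p + 1)"
  shows "((\<lambda>\<xi>. poly (expansion \<phi> v) \<xi> * poly (expansion \<phi> w) \<xi>)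
    has_integral (v \<bullet> (exact_mass_mat p \<phi> *\<^sub>v w))) {-1..1}"
proof -
  define m where "m i j = integral {-1..1} (\<lambda>\<xi>. poly (\<phi> i) \<xi> * poly (\<phi> j) \<xi>)" for i j
  have m: "((\<lambda>\<xi>. poly (\<phi> i) \<xi> * poly (\<phi> j) \<xi>) has_integral m i j) {-1..1}" for i j
    unfolding m_def by (intro integrable_integral integrable_continuous_real continuous_intros)
  have "((\<lambda>\<xi>. \<Sum>i<p+1. \<Sum>j<p+1. (v $ i * w $ j) * (poly (\<phi> i) \<xi> * poly (\<phi> j) \<xi>))
      has_integral (\<Sum>i<p+1. \<Sum>j<p+1. (v $ i * w $ j) * m i j)) {-1..1}"
    by (intro has_integral_sum has_integral_mult_right m) auto
  moreover have "(\<Sum>i<p+1. \<Sum>j<p+1. (v $ i * w $ j) * (poly (\<phi> i) \<xi> * poly (\<phi> j) \<xi>)) =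
      poly (expansion \<phi> v) \<xi> * poly (expansion \<phi> w) \<xi>" for \<xi>
    using v w by (simp add: expansion_def poly_sum sum_product mult_ac del: sum.lessThan_Suc)
  moreover have "v \<bullet> (exact_mass_mat p \<phi> *\<^sub>v w) = (\<Sum>i<p+1. \<Sum>j<p+1. (v $ i * w $ j) * m i j)"
    using v w
    by (simp add: scalar_prod_def exact_mass_mat_def m_def[symmetric] sum_distrib_left
        mult_ac atLeast0LessThan del: sum.lessThan_Suc)
  ultimately show ?thesis by simp
qed

text \<open>The projection error is orthogonal to every test polynomial, so the projection can be
  dropped from the weak form.\<close>

lemma projected_mult_bilinear_form:
  assumes basis: "poly_basis p \<phi>" and J: "projected_mult_mat p \<phi> g J"
    and v: "v \<in> carrier_vec (p + 1)" and w: "w \<in> carrier_vec (p + 1)"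
  shows "((\<lambda>\<xi>. g \<xi> * (poly (expansion \<phi> v) \<xi> * poly (expansion \<phi> w) \<xi>))
    has_integral (v \<bullet> ((exact_mass_mat p \<phi> * J) *\<^sub>v w))) {-1..1}"
proof -
  have Jc: "J \<in> carrier_mat (p + 1) (p + 1)"
    and proj: "L2_projection p (\<lambda>\<xi>. g \<xi> * poly (expansion \<phi> w) \<xi>) (expansion \<phi> (J *\<^sub>v w))"
    using J w unfolding projected_mult_mat_def by auto
  have Mc: "exact_mass_mat p \<phi> \<in> carrier_mat (p + 1) (p + 1)" by (simp add: exact_mass_mat_def)
  have "((\<lambda>\<xi>. (g \<xi> * poly (expansion \<phi> w) \<xi> - poly (expansion \<phi> (J *\<^sub>v w)) \<xi>) *
      poly (expansion \<phi> v) \<xi>) has_integral 0) {-1..1}"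
    using proj degree_expansion_le[OF basis v] unfolding L2_projection_def by blast
  moreover have "((\<lambda>\<xi>. poly (expansion \<phi> v) \<xi> * poly (expansion \<phi> (J *\<^sub>v w)) \<xi>)
      has_integral (v \<bullet> (exact_mass_mat p \<phi> *\<^sub>v (J *\<^sub>v w)))) {-1..1}"
    using exact_mass_mat_bilinear_form[OF v, of "J *\<^sub>v w"] Jc w by simp
  ultimately have "((\<lambda>\<xi>. (g \<xi> * poly (expansion \<phi> w) \<xi> - poly (expansion \<phi> (J *\<^sub>v w)) \<xi>) *
      poly (expansion \<phi> v) \<xi> + poly (expansion \<phi> v) \<xi> * poly (expansion \<phi> (J *\<^sub>v w)) \<xi>)
      has_integral (0 + v \<bullet> (exact_mass_mat p \<phi> *\<^sub>v (J *\<^sub>v w)))) {-1..1}"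
    by (rule has_integral_add)
  then show ?thesis
    unfolding assoc_mult_mat_vec[OF Mc Jc w] by (simp add: algebra_simps)
qed

lemma sym_pos_def_exact_mass_projected_mult:
  fixes G g :: "real \<Rightarrow> real"
  assumes basis: "poly_basis p \<phi>" and J: "projected_mult_mat p \<phi> g J"
    and deriv: "\<And>t. t \<in> {-1..1} \<Longrightarrow> (G has_real_derivative g t) (at t within {-1..1})"
    and pos: "\<And>t. t \<in> {-1..1} \<Longrightarrow> g t > 0"
  shows "sym_pos_def (p + 1) (exact_mass_mat p \<phi> * J)"
proof (rule sym_pos_defI)
  show "exact_mass_mat p \<phi> * J \<in> carrier_mat (p + 1) (p + 1)"
    using J by (auto simp: projected_mult_mat_def exact_mass_mat_def)
next
  fix v w :: "real vec" assume vw: "v \<in> carrier_vec (p + 1)" "w \<in> carrier_vec (p + 1)"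
  show "v \<bullet> ((exact_mass_mat p \<phi> * J) *\<^sub>v w) = w \<bullet> ((exact_mass_mat p \<phi> * J) *\<^sub>v v)"
    using projected_mult_bilinear_form[OF basis J vw] projected_mult_bilinear_form[OF basis J vw(2,1)]
    by (simp add: mult.commute has_integral_unique)
next
  fix v :: "real vec" assume v: "v \<in> carrier_vec (p + 1)" "v \<noteq> 0\<^sub>v (p + 1)"
  define q where "q = expansion \<phi> v"
  have "q \<noteq> 0" unfolding q_def using expansion_eq_0_iff[OF basis v(1)] v(2) by simp
  then have "finite {t. poly q t = 0}" by (rule poly_roots_finite)
  moreover have "infinite {-1..<1::real}" by simp
  ultimately obtain c where c: "c \<in> {-1..<1}" "poly q c \<noteq> 0"
    by (metis (mono_tags, lifting) finite_subset mem_Collect_eq subsetI)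
  have sq: "poly q c * poly q c > 0" using c(2) not_real_square_gt_zero by blast
  show "v \<bullet> ((exact_mass_mat p \<phi> * J) *\<^sub>v v) > 0"
  proof (rule has_integral_derivative_weight_pos[OF deriv pos _ _ c(1)])
    show "((\<lambda>t. g t * (poly q t * poly q t)) has_integral
        (v \<bullet> ((exact_mass_mat p \<phi> * J) *\<^sub>v v))) {-1..1}"
      unfolding q_def by (rule projected_mult_bilinear_form[OF basis J v(1) v(1)])
  qed (use sq in \<open>auto intro!: continuous_intros\<close>)
qed

section \<open>Conservation, energy balance and positivity on the mapped element\<close>

theorem mainTheorem2:
  fixes p :: nat
    and \<phi> :: "nat \<Rightarrow> real poly"
    and M D R B J :: "real mat"
    and one :: "real vec"
    and x Jac :: "real \<Rightarrow> real"
  assumes basis: "poly_basis p \<phi>"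
    and one: "one \<in> carrier_vec (p + 1)" "expansion \<phi> one = 1"
    and M: "sym_pos_def (p + 1) M"
    and D: "D \<in> carrier_mat (p + 1) (p + 1)" "D *\<^sub>v one = 0\<^sub>v (p + 1)"
    and R: "R = restriction_mat p \<phi>"
    and B: "B = mat_diag 2 (\<lambda>i. if i = 0 then -1 else 1)"
    and SBP: "M * D + D\<^sup>T * M = R\<^sup>T * B * R"
    and J: "J \<in> carrier_mat (p + 1) (p + 1)"
    and mapping:
      "\<And>\<xi>. \<xi> \<in> {-1..1} \<Longrightarrow> (x has_real_derivative Jac \<xi>) (at \<xi> within {-1..1})"
  shows
    "(\<forall>(T :: real set) u u' fnum.
       is_interval T \<and>
       vec_has_derivative_on (p + 1) u u' T \<and>
       (\<forall>t\<in>T. fnum t \<in> carrier_vec 2) \<and>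
       (\<forall>t\<in>T. J *\<^sub>v u' t + D *\<^sub>v u t
                + (mat_inv M * R\<^sup>T * B) *\<^sub>v (fnum t - R *\<^sub>v u t) = 0\<^sub>v (p + 1)) \<longrightarrow>
       (\<forall>t\<in>T.
          one \<bullet> ((M * J) *\<^sub>v u' t) = - (one \<bullet> ((R\<^sup>T * B) *\<^sub>v fnum t)) \<and>
          u t \<bullet> ((M * J) *\<^sub>v u' t)
            = - (u t \<bullet> ((R\<^sup>T * B) *\<^sub>v (fnum t - (1/2) \<cdot>\<^sub>v (R *\<^sub>v u t)))))) \<and>
    ((\<forall>\<xi>\<in>{-1..1}. Jac \<xi> > 0) \<longrightarrow>
       (\<forall>node \<omega>.
          nodal_basis p \<phi> node \<and> (\<forall>i\<le>p. \<omega> i > 0) \<and>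
          M = mat_diag (p + 1) \<omega> \<and>
          J = mat_diag (p + 1) (\<lambda>i. Jac (node i)) \<longrightarrow>
          sym_pos_def (p + 1) (M * J)) \<and>
       ((\<forall>i\<le>p. \<phi> i = legendre i) \<and>
          M = exact_mass_mat p \<phi> \<and>
          projected_mult_mat p \<phi> Jac J \<longrightarrow>
          sym_pos_def (p + 1) (M * J)) \<and>
       (\<forall>\<phi>\<^sub>0 V M\<^sub>0 J\<^sub>0.
          poly_basis p \<phi>\<^sub>0 \<and> basis_change p \<phi>\<^sub>0 \<phi> V \<and>
          M\<^sub>0 \<in> carrier_mat (p + 1) (p + 1) \<and> J\<^sub>0 \<in> carrier_mat (p + 1) (p + 1) \<and>
          sym_pos_def (p + 1) (M\<^sub>0 * J\<^sub>0) \<and>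
          M = V\<^sup>T * M\<^sub>0 * V \<and> J = mat_inv V * J\<^sub>0 * V \<longrightarrow>
          sym_pos_def (p + 1) (M * J)))"
proof (intro conjI impI allI ballI; (elim conjE)?)
  have Rc: "R \<in> carrier_mat 2 (p + 1)" unfolding R restriction_mat_def by simp
  have Bc: "B \<in> carrier_mat 2 2" unfolding B by simp
  fix T :: "real set" and u u' fnum t
  assume "t \<in> T" "vec_has_derivative_on (p + 1) u u' T" "\<forall>t\<in>T. fnum t \<in> carrier_vec 2"
    and ode: "\<forall>t\<in>T. J *\<^sub>v u' t + D *\<^sub>v u t
      + (mat_inv M * R\<^sup>T * B) *\<^sub>v (fnum t - R *\<^sub>v u t) = 0\<^sub>v (p + 1)"
  then have c: "u t \<in> carrier_vec (p + 1)" "u' t \<in> carrier_vec (p + 1)" "fnum t \<in> carrier_vec 2"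
    and eq: "J *\<^sub>v u' t + D *\<^sub>v u t
      + (mat_inv M * R\<^sup>T * B) *\<^sub>v (fnum t - R *\<^sub>v u t) = 0\<^sub>v (p + 1)"
    unfolding vec_has_derivative_on_def by auto
  show "one \<bullet> ((M * J) *\<^sub>v u' t) = - (one \<bullet> ((R\<^sup>T * B) *\<^sub>v fnum t))"
    by (rule SBP_conservation[OF M D(1) J Rc Bc SBP one(1) c eq D(2)])
  show "u t \<bullet> ((M * J) *\<^sub>v u' t)
      = - (u t \<bullet> ((R\<^sup>T * B) *\<^sub>v (fnum t - (1/2) \<cdot>\<^sub>v (R *\<^sub>v u t))))"
    by (rule SBP_energy[OF M D(1) J Rc Bc SBP c eq])
next
  fix node \<omega>
  assume pos: "\<forall>\<xi>\<in>{-1..1}. Jac \<xi> > 0" and nodal: "nodal_basis p \<phi> node"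
    and \<omega>: "\<forall>i\<le>p. \<omega> i > 0"
    and eqs: "M = mat_diag (p + 1) \<omega>" "J = mat_diag (p + 1) (\<lambda>i. Jac (node i))"
  have "0 < \<omega> i * Jac (node i)" if "i < p + 1" for i
    using that pos nodal \<omega> unfolding nodal_basis_def by (intro mult_pos_pos) auto
  then show "sym_pos_def (p + 1) (M * J)"
    unfolding eqs mat_diag_diag by (rule sym_pos_def_mat_diag)
next
  assume pos: "\<forall>\<xi>\<in>{-1..1}. Jac \<xi> > 0"
    and M_exact: "M = exact_mass_mat p \<phi>" and proj: "projected_mult_mat p \<phi> Jac J"
  show "sym_pos_def (p + 1) (M * J)"
    unfolding M_exact
    by (rule sym_pos_def_exact_mass_projected_mult[OF basis proj mapping]) (use pos in auto)
next
  fix \<phi>\<^sub>0 V M\<^sub>0 J\<^sub>0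
  assume bc: "basis_change p \<phi>\<^sub>0 \<phi> V"
    and c: "M\<^sub>0 \<in> carrier_mat (p + 1) (p + 1)" "J\<^sub>0 \<in> carrier_mat (p + 1) (p + 1)"
    and spd: "sym_pos_def (p + 1) (M\<^sub>0 * J\<^sub>0)"
    and eqs: "M = V\<^sup>T * M\<^sub>0 * V" "J = mat_inv V * J\<^sub>0 * V"
  have V: "V \<in> carrier_mat (p + 1) (p + 1)" "invertible_mat V"
    using bc unfolding basis_change_def by auto
  note Vi = invertible_mat_inverse[OF V]
  have "M * J = (V\<^sup>T * M\<^sub>0) * ((V * mat_inv V) * (J\<^sub>0 * V))"
    unfolding eqs using c V(1) Vi(3)
    by (simp add: assoc_mult_mat[of _ "p + 1" "p + 1" _ "p + 1" _ "p + 1"])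
  also have "\<dots> = V\<^sup>T * (M\<^sub>0 * J\<^sub>0) * V"
    unfolding Vi(1) using c V(1)
    by (simp add: assoc_mult_mat[of _ "p + 1" "p + 1" _ "p + 1" _ "p + 1"])
  finally show "sym_pos_def (p + 1) (M * J)"
    using sym_pos_def_congruence[OF spd V] by simp
qed

end
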